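(* Let $\mathcal{W}$ be a complex vector space, let $x$, $\log x$, $y$ be independent commuting formal variables, and let $$f(x)=\sum_{m,n\in\mathbb{C}}w_{n,m}x^n(\log x)^m\in\mathcal{W}\{x,\log x\},\qquad w_{n,m}\in\mathcal{W},$$ be an arbitrary formal series in arbitrary complex powers of $x$ and of $\log x$. Then $$e^{y\frac{d}{dx}}f(x)=f(x+y)$$ and $$e^{yx\frac{d}{dx}}f(x)=f(xe^y).$$
   Context: $\mathbb{N}=\{0,1,2,\dots\}$. $\mathcal{W}\{x,\log x\}$ is the space of all formal series $\sum_{m,n\in\mathbb{C}}w_{n,m}x^n(\log x)^m$ with arbitrary coefficients $w_{n,m}\in\mathcal{W}$ (no finiteness condition), where $\log x$ is a formal variable independent of $x$ (the relation $x=e^{\log x}$ is not imposed). The linear map $\frac{d}{dx}$ on $\mathcal{W}\{x,\log x\}$ is defined by $$\frac{d}{dx}\Big(\sum_{m,n}w_{n,m}x^n(\log x)^m\Big)=\sum_{m,n\in\mathbb{C}}\big((n+1)w_{n+1,m}+(m+1)w_{n+1,m+1}\big)x^n(\log x)^m .$$ For $T=\frac{d}{dx}$ or $T=x\frac{d}{dx}$, $e^{yT}=\sum_{k\in\mathbb{N}}\frac{y^k}{k!}T^k$, so $e^{yT}f(x)\in\mathcal{W}\{x,\log x\}[[y]]$. The substitutions are defined by $$f(x+y)=\sum_{m,n\in\mathbb{C}}w_{n,m}(x+y)^n\Big(\log x+\sum_{i\ge1}\frac{(-1)^{i-1}}{i}\Big(\frac yx\Big)^i\Big)^m,$$ $$f(xe^y)=\sum_{m,n\in\mathbb{C}}w_{n,m}x^ne^{ny}(\log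 x+y)^m .$$ Here every complex power of a sum is expanded by the binomial series in nonnegative integral powers of the second summand: $(x+y)^n=\sum_{j\in\mathbb{N}}\binom nj x^{n-j}y^j$, $(\log x+y)^m=\sum_{j\in\mathbb{N}}\binom mj(\log x)^{m-j}y^j$, and $(\log x+X)^m=\sum_{j\in\mathbb{N}}\binom mj(\log x)^{m-j}X^j$ with $X=\sum_{i\ge1}\frac{(-1)^{i-1}}{i}(y/x)^i$. Both $f(x+y)$ and $f(xe^y)$ are well-defined elements of $\mathcal{W}\{x,\log x\}[[y]]$. *)

theory Defs
  imports
    "HOL-Computational_Algebra.Formal_Power_Series"
    "HOL-Library.Poly_Mapping"
    "HOL-Library.Product_Plus"
begin

unbundle fps_syntax

text \<open>
  The space \<open>\<W>{x, log x}\<close>: a series is its coefficient function, \<open>w n m\<close> being the coefficient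
  of \<open>x\<^sup>n (log x)\<^sup>m\<close>. The index order is that of \<open>w\<^sub>n\<^sub>,\<^sub>m\<close>, and \<open>scale\<close> is the scalar
  multiplication of the complex vector space \<open>\<W>\<close>.
\<close>

type_synonym 'w log_series = "complex \<Rightarrow> complex \<Rightarrow> 'w"

definition ddx :: "(complex \<Rightarrow> 'w \<Rightarrow> 'w::ab_group_add) \<Rightarrow> 'w log_series \<Rightarrow> 'w log_series" where
  "ddx scale w = (\<lambda>n m. scale (n + 1) (w (n + 1) m) + scale (m + 1) (w (n + 1) (m + 1)))"

definition mult_x :: "'w log_series \<Rightarrow> 'w log_series" where
  "mult_x w = (\<lambda>n m. w (n - 1) m)"

definition x_ddx :: "(complex \<Rightarrow> 'w \<Rightarrow> 'w::ab_group_add) \<Rightarrow> 'w log_series \<Rightarrow> 'w log_series" where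
  "x_ddx scale w = mult_x (ddx scale w)"

definition exp_y ::
  "(complex \<Rightarrow> 'w \<Rightarrow> 'w::ab_group_add) \<Rightarrow> ('w log_series \<Rightarrow> 'w log_series) \<Rightarrow>
    'w log_series \<Rightarrow> 'w log_series fps" where
  "exp_y scale T w = Abs_fps (\<lambda>k n m. scale (1 / fact k) ((T ^^ k) w n m))"

text \<open>
  Finite complex linear combinations of the monomials \<open>x\<^sup>a (log x)\<^sup>b\<close> (keyed by \<open>(a, b)\<close>) form a
  commutative ring; the expansions of the individual terms \<open>(x + y)\<^sup>n (log x + \<dots>)\<^sup>m\<close> and
  \<open>x\<^sup>n e\<^bsup>ny\<^esup> (log x + y)\<^sup>m\<close> are power series in \<open>y\<close> over this ring.
\<close>

type_synonym log_poly = "(complex \<times> complex) \<Rightarrow>\<^sub>0 complex"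

definition coeff_const :: "complex \<Rightarrow> log_poly" where
  "coeff_const c = Poly_Mapping.single (0, 0) c"

definition x_pow :: "complex \<Rightarrow> log_poly" where
  "x_pow a = Poly_Mapping.single (a, 0) 1"

definition logx_pow :: "complex \<Rightarrow> log_poly" where
  "logx_pow b = Poly_Mapping.single (0, b) 1"

text \<open>
  \<open>binomial_pow p s\<close> is \<open>(z + y)\<^sup>s\<close>, where \<open>p a\<close> stands for \<open>z\<^sup>a\<close>, expanded in nonnegative powers
  of \<open>y\<close>. Composing it with a power series \<open>X\<close> in \<open>y\<close> without constant term gives \<open>(z + X)\<^sup>s\<close>.
\<close>

definition binomial_pow :: "(complex \<Rightarrow> log_poly) \<Rightarrow> complex \<Rightarrow> log_poly fps" where
  "binomial_pow p s = Abs_fps (\<lambda>j. coeff_const (s gchoose j) * p (s - of_nat j))"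

definition log_shift :: "log_poly fps" where
  "log_shift = Abs_fps (\<lambda>i. if i = 0 then 0
    else coeff_const ((- 1) ^ (i - 1) / of_nat i) * x_pow (- of_nat i))"

definition term_add :: "complex \<Rightarrow> complex \<Rightarrow> log_poly fps" where
  "term_add n m = binomial_pow x_pow n * (binomial_pow logx_pow m oo log_shift)"

definition term_exp :: "complex \<Rightarrow> complex \<Rightarrow> log_poly fps" where
  "term_exp n m =
    fps_const (x_pow n) * Abs_fps (\<lambda>k. coeff_const (n ^ k / fact k)) * binomial_pow logx_pow m"

text \<open>
  \<open>subst_terms scale E w\<close> is the formal sum of \<open>w\<^sub>n\<^sub>,\<^sub>m E\<^sub>n\<^sub>,\<^sub>m\<close> over all \<open>n\<close>, \<open>m\<close>, taken
  coefficientwise. As \<^const>\<open>Sum_any\<close> is \<open>0\<close> on infinite support, this is meaningful only if each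
  coefficient receives finitely many nonzero contributions; the lemmas \<open>subst_add_finite\<close> and
  \<open>subst_exp_finite\<close> below show that this is always so for the two substitutions considered.
\<close>

definition subst_terms ::
  "(complex \<Rightarrow> 'w \<Rightarrow> 'w::ab_group_add) \<Rightarrow> (complex \<Rightarrow> complex \<Rightarrow> log_poly fps) \<Rightarrow>
    'w log_series \<Rightarrow> 'w log_series fps" where
  "subst_terms scale E w =
    Abs_fps (\<lambda>k a b. Sum_any (\<lambda>(n, m). scale (Poly_Mapping.lookup (E n m $ k) (a, b)) (w n m)))"

definition subst_add :: "(complex \<Rightarrow> 'w \<Rightarrow> 'w::ab_group_add) \<Rightarrow> 'w log_series \<Rightarrow> 'w log_series fps" where
  "subst_add scale w = subst_terms scale term_add w"

definition subst_exp :: "(complex \<Rightarrow> 'w \<Rightarrow> 'w::ab_group_add) \<Rightarrow> 'w log_series \<Rightarrow> 'w log_series fps" where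
  "subst_exp scale w = subst_terms scale term_exp w"

text \<open>
  \<open>shifts n m k l\<close> contains the exponent pairs \<open>(n - i, m - j)\<close> with \<open>i \<le> k\<close>, \<open>j \<le> l\<close>. The exponents
  occurring in the coefficients of the two expansions lie in such sets.
\<close>

definition shifts :: "complex \<Rightarrow> complex \<Rightarrow> nat \<Rightarrow> nat \<Rightarrow> (complex \<times> complex) set" where
  "shifts n m k l = (\<lambda>(i, j). (n - of_nat i, m - of_nat j)) ` ({..k} \<times> {..l})"

lemma shifts_mono: "k \<le> k' \<Longrightarrow> l \<le> l' \<Longrightarrow> shifts n m k l \<subseteq> shifts n m k' l'"
  unfolding shifts_def by (intro image_mono Sigma_mono) auto

lemma shiftsI: "i \<le> k \<Longrightarrow> j \<le> l \<Longrightarrow> (n - of_nat i, m - of_nat j) \<in> shifts n m k l"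
  unfolding shifts_def by force

lemma keys_times_shifts:
  fixes p q :: log_poly
  assumes "Poly_Mapping.keys p \<subseteq> shifts n m k l" "Poly_Mapping.keys q \<subseteq> shifts n' m' k' l'"
  shows "Poly_Mapping.keys (p * q) \<subseteq> shifts (n + n') (m + m') (k + k') (l + l')"
proof
  fix e assume "e \<in> Poly_Mapping.keys (p * q)"
  then obtain u v where e: "e = u + v" and "u \<in> shifts n m k l" "v \<in> shifts n' m' k' l'"
    using keys_mult[of p q] assms by blast
  then obtain a b c d where uv: "u = (n - of_nat a, m - of_nat b)" "v = (n' - of_nat c, m' - of_nat d)"
    and le: "a \<le> k" "b \<le> l" "c \<le> k'" "d \<le> l'"
    unfolding shifts_def by auto
  have "e = (n + n' - of_nat (a + c), m + m' - of_nat (b + d))"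
    using e uv by simp
  then show "e \<in> shifts (n + n') (m + m') (k + k') (l + l')"
    using shiftsI[of "a + c" "k + k'" "b + d" "l + l'"] le by simp
qed

lemma keys_sum_shifts:
  fixes p :: "nat \<Rightarrow> log_poly"
  assumes "\<And>i. i \<in> I \<Longrightarrow> Poly_Mapping.keys (p i) \<subseteq> shifts n m k l"
  shows "Poly_Mapping.keys (sum p I) \<subseteq> shifts n m k l"
  using keys_sum[of p I] assms by blast

lemma keys_fps_times_shifts:
  fixes F G :: "log_poly fps"
  assumes F: "\<And>k. Poly_Mapping.keys (F $ k) \<subseteq> shifts n m (\<alpha> * k) (\<beta> * k)"
    and G: "\<And>k. Poly_Mapping.keys (G $ k) \<subseteq> shifts n' m' (\<alpha> * k) (\<beta> * k)"
  shows "Poly_Mapping.keys ((F * G) $ k) \<subseteq> shifts (n + n') (m + m') (\<alpha> * k) (\<beta> * k)"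
  unfolding fps_mult_nth
proof (rule keys_sum_shifts)
  fix i assume "i \<in> {0..k}"
  then have "\<alpha> * i + \<alpha> * (k - i) = \<alpha> * k" "\<beta> * i + \<beta> * (k - i) = \<beta> * k"
    by (simp_all flip: add_mult_distrib2)
  with keys_times_shifts[OF F[of i] G[of "k - i"]]
  show "Poly_Mapping.keys (F $ i * G $ (k - i)) \<subseteq> shifts (n + n') (m + m') (\<alpha> * k) (\<beta> * k)"
    by simp
qed

lemma keys_binomial_x: "Poly_Mapping.keys (binomial_pow x_pow n $ k) \<subseteq> shifts n 0 k 0"
  unfolding binomial_pow_def coeff_const_def x_pow_def
  by (simp add: mult_single) (metis diff_zero le_refl of_nat_0 shiftsI)

lemma keys_binomial_logx: "Poly_Mapping.keys (binomial_pow logx_pow m $ k) \<subseteq> shifts 0 m 0 k"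
  unfolding binomial_pow_def coeff_const_def logx_pow_def
  by (simp add: mult_single) (metis diff_zero le_refl of_nat_0 shiftsI)

lemma keys_log_shift: "Poly_Mapping.keys (log_shift $ k) \<subseteq> shifts 0 0 k 0"
  unfolding log_shift_def coeff_const_def x_pow_def
  by (simp add: mult_single) (metis diff_0 diff_zero le_refl of_nat_0 shiftsI)

lemma keys_log_shift_power: "Poly_Mapping.keys ((log_shift ^ j) $ k) \<subseteq> shifts 0 0 k 0"
proof (induction j arbitrary: k)
  case 0
  have "(0, 0) \<in> shifts 0 0 i 0" for i
    using shiftsI[of 0 i 0 0 0 0] by simp
  then show ?case by (simp add: zero_prod_def)
next
  case (Suc j)
  show ?case
    using keys_fps_times_shifts[of log_shift 0 0 1 0 "log_shift ^ j" 0 0 k] keys_log_shift Suc.IH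
    by simp
qed

lemma keys_log_compose:
  "Poly_Mapping.keys ((binomial_pow logx_pow m oo log_shift) $ k) \<subseteq> shifts 0 m k k"
  unfolding fps_compose_nth
proof (rule keys_sum_shifts)
  fix i assume "i \<in> {0..k}"
  then have "shifts 0 m k i \<subseteq> shifts 0 m k k"
    by (intro shifts_mono) auto
  with keys_times_shifts[OF keys_binomial_logx[of m i] keys_log_shift_power[of i k]]
  show "Poly_Mapping.keys (binomial_pow logx_pow m $ i * (log_shift ^ i) $ k) \<subseteq> shifts 0 m k k"
    by simp
qed

lemma keys_term_add: "Poly_Mapping.keys (term_add n m $ k) \<subseteq> shifts n m k k"
proof -
  have "Poly_Mapping.keys (binomial_pow x_pow n $ i) \<subseteq> shifts n 0 (1 * i) (1 * i)" for i
    using keys_binomial_x shifts_mono[of i i 0 i] by fastforce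
  from keys_fps_times_shifts[OF this, of "binomial_pow logx_pow m oo log_shift" 0 m k]
  show ?thesis
    using keys_log_compose by (simp add: term_add_def)
qed

lemma keys_term_exp: "Poly_Mapping.keys (term_exp n m $ k) \<subseteq> shifts n m k k"
proof -
  have "Poly_Mapping.keys ((fps_const (x_pow n) * Abs_fps (\<lambda>k. coeff_const (n ^ k / fact k))) $ i)
      \<subseteq> shifts n 0 (1 * i) (1 * i)" for i
    using shiftsI[of 0 i 0 i n 0] by (simp add: coeff_const_def x_pow_def mult_single)
  moreover have "Poly_Mapping.keys (binomial_pow logx_pow m $ i) \<subseteq> shifts 0 m (1 * i) (1 * i)" for i
    using keys_binomial_logx shifts_mono[of 0 i i i] by fastforce
  ultimately show ?thesis
    using keys_fps_times_shifts[of _ n 0 1 1 _ 0 m k] by (simp add: term_exp_def)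
qed

lemma subst_terms_finite:
  assumes "vector_space scale"
    and "\<And>n m. Poly_Mapping.keys (E n m $ k) \<subseteq> shifts n m k k"
  shows "finite {(n, m). scale (Poly_Mapping.lookup (E n m $ k) (a, b)) (w n m) \<noteq> 0}"
proof -
  interpret vector_space scale by fact
  have "{(n, m). scale (Poly_Mapping.lookup (E n m $ k) (a, b)) (w n m) \<noteq> 0}
      \<subseteq> (\<lambda>(i, j). (a + of_nat i, b + of_nat j)) ` ({..k} \<times> {..k})"
  proof clarify
    fix n m assume "scale (Poly_Mapping.lookup (E n m $ k) (a, b)) (w n m) \<noteq> 0"
    then have "(a, b) \<in> Poly_Mapping.keys (E n m $ k)"
      by (auto simp: in_keys_iff)
    with assms(2) have "(a, b) \<in> shifts n m k k" by blast
    then show "(n, m) \<in> (\<lambda>(i, j). (a + of_nat i, b + of_nat j)) ` ({..k} \<times> {..k})"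
      unfolding shifts_def by force
  qed
  then show ?thesis by (rule finite_subset) simp
qed

lemmas subst_add_finite = subst_terms_finite[where E = term_add, OF _ keys_term_add]
lemmas subst_exp_finite = subst_terms_finite[where E = term_exp, OF _ keys_term_exp]

end

(* Both d/dx and x d/dx send x^n (log x)^m to n x^(n-d) (log x)^m + m x^(n-d) (log x)^(m-1), with
   d = 1 and d = 0 respectively. The expanded terms E_(n,m) of f(x + y) and f(x e^y) have constant
   term x^n (log x)^m and satisfy dE_(n,m)/dy = n E_(n-d,m) + m E_(n-d,m-1). Hence the coefficient
   of y^(k+1) in the substitution into f is 1/(k+1) times that of y^k in the substitution into the
   derivative of f, and the theorem follows by induction on k. *)

theory Submission
  imports Defs
begin

section \<open>The two derivations as members of one family indexed by the shift d\<close>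

definition log_deriv ::
  "(complex \<Rightarrow> 'w \<Rightarrow> 'w::ab_group_add) \<Rightarrow> complex \<Rightarrow> 'w log_series \<Rightarrow> 'w log_series" where
  "log_deriv scale d w =
    (\<lambda>n m. scale (n + d) (w (n + d) m) + scale (m + 1) (w (n + d) (m + 1)))"

lemma ddx_eq_log_deriv: "ddx scale = log_deriv scale 1"
  by (simp add: fun_eq_iff ddx_def log_deriv_def)

lemma x_ddx_eq_log_deriv: "x_ddx scale = log_deriv scale 0"
  by (simp add: fun_eq_iff x_ddx_def mult_x_def ddx_def log_deriv_def)

section \<open>Arithmetic of monomials and the chain rule over their ring\<close>

lemma coeff_const_mult: "coeff_const a * coeff_const b = coeff_const (a * b)"
  by (simp add: coeff_const_def mult_single)

lemma coeff_const_of_nat: "of_nat k = coeff_const (of_nat k)"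
  using single_of_nat[of k, where 'a = "complex \<times> complex" and 'b = complex]
  by (simp add: coeff_const_def zero_prod_def)

lemma coeff_const_sum: "coeff_const (sum f I) = (\<Sum>i\<in>I. coeff_const (f i))"
  by (induction I rule: infinite_finite_induct) (simp_all add: coeff_const_def single_add)

lemma coeff_const_1 [simp]: "coeff_const 1 = 1"
  using coeff_const_of_nat[of 1] by simp

text \<open>Used to turn an identity in \<open>log_poly\<close> into one between complex numbers, at
  a fixed exponent pair.\<close>

lemma lookup_coeff_const_mult:
  "Poly_Mapping.lookup (coeff_const c * p) e = c * Poly_Mapping.lookup p e"
proof -
  have "coeff_const c * p = Poly_Mapping.map ((*) c) p"
    by (simp add: mult_map_scale_conv_mult coeff_const_def zero_prod_def)
  then show ?thesis
    by (simp add: map.rep_eq when_def)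
qed

lemma x_pow_mult: "x_pow a * x_pow b = x_pow (a + b)"
  by (simp add: x_pow_def mult_single)

(* The library's fps_compose_deriv asks for an integral domain, and log_poly is not known to be one. *)
lemma fps_deriv_compose_comm_ring:
  fixes a b :: "'a::comm_ring_1 fps"
  assumes "b $ 0 = 0"
  shows "fps_deriv (a oo b) = (fps_deriv a oo b) * fps_deriv b"
proof (rule fps_ext)
  fix k
  have vanish: "(b ^ i) $ j = 0" if "j < i" for i j
    using startsby_zero_power_prefix[OF assms, of i] that by blast
  have "fps_deriv (a oo b) $ k = (\<Sum>i=0..Suc k. a $ i * fps_deriv (b ^ i) $ k)"
    by (simp add: fps_compose_nth sum_distrib_left mult_ac del: of_nat_Suc sum.cl_ivl_Suc)
  \<comment> \<open>The summand i = 0 drops out, since \<open>b ^ 0\<close> is constant.\<close>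
  also have "\<dots> = (\<Sum>i=0..k. a $ Suc i * fps_deriv (b ^ Suc i) $ k)"
    by (subst sum.atLeast0_atMost_Suc_shift) (simp del: fps_deriv_nth power_Suc)
  also have "\<dots> = (\<Sum>i=0..k. fps_deriv a $ i * (b ^ i * fps_deriv b) $ k)"
  proof (rule sum.cong)
    fix i
    have "fps_deriv (b ^ Suc i) = fps_const (of_nat (Suc i)) * (b ^ i * fps_deriv b)"
      by (subst fps_deriv_power) (simp add: mult_ac)
    then show "a $ Suc i * fps_deriv (b ^ Suc i) $ k = fps_deriv a $ i * (b ^ i * fps_deriv b) $ k"
      by (simp only: fps_mult_left_const_nth fps_deriv_nth[of a]) (simp add: mult_ac)
  qed simp
  also have "\<dots> = (\<Sum>i=0..k. \<Sum>j=0..k. fps_deriv a $ i * (b ^ i) $ j * fps_deriv b $ (k - j))"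
    by (simp add: fps_mult_nth sum_distrib_left mult.assoc)
  also have "\<dots> = (\<Sum>j=0..k. (\<Sum>i=0..k. fps_deriv a $ i * (b ^ i) $ j) * fps_deriv b $ (k - j))"
    by (subst sum.swap) (simp add: sum_distrib_right)
  also have "\<dots> = (\<Sum>j=0..k. (fps_deriv a oo b) $ j * fps_deriv b $ (k - j))"
  proof (rule sum.cong)
    fix j assume "j \<in> {0..k}"
    \<comment> \<open>Composition sums only over i up to j; the extra summands up to k vanish
      because \<open>b ^ i\<close> has no terms of order below i.\<close>
    then have "(\<Sum>i=0..k. fps_deriv a $ i * (b ^ i) $ j) = (fps_deriv a oo b) $ j"
      unfolding fps_compose_nth
      by (intro sum.mono_neutral_right) (auto simp: vanish)
    then show "(\<Sum>i=0..k. fps_deriv a $ i * (b ^ i) $ j) * fps_deriv b $ (k - j)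
        = (fps_deriv a oo b) $ j * fps_deriv b $ (k - j)"
      by simp
  qed simp
  finally show "fps_deriv (a oo b) $ k = ((fps_deriv a oo b) * fps_deriv b) $ k"
    by (simp add: fps_mult_nth)
qed

lemma fps_const_mult_compose:
  fixes F G :: "'a::comm_ring_1 fps"
  shows "(fps_const c * F) oo G = fps_const c * (F oo G)"
  by (rule fps_ext) (simp add: fps_compose_nth sum_distrib_left mult.assoc)

section \<open>Differential equations and constant terms of the expansions\<close>

lemma fps_deriv_binomial_pow:
  "fps_deriv (binomial_pow p s) = fps_const (coeff_const s) * binomial_pow p (s - 1)"
proof (rule fps_ext)
  fix k
  have "fps_deriv (binomial_pow p s) $ k
      = coeff_const (of_nat (Suc k) * (s gchoose Suc k)) * p (s - of_nat (Suc k))"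
    by (simp add: binomial_pow_def coeff_const_of_nat coeff_const_mult flip: mult.assoc of_nat_Suc
        del: of_nat_Suc)
  \<comment> \<open>Absorption trades the factor k + 1 for s. Only binomial coefficients change, so
    one rule serves the powers of x and of log x.\<close>
  also have "\<dots> = coeff_const s * (coeff_const ((s - 1) gchoose k) * p (s - 1 - of_nat k))"
    unfolding gbinomial_absorption by (simp add: coeff_const_mult algebra_simps flip: mult.assoc)
  finally show "fps_deriv (binomial_pow p s) $ k
      = (fps_const (coeff_const s) * binomial_pow p (s - 1)) $ k"
    by (simp add: binomial_pow_def)
qed

text \<open>All products contributing to y^k carry the same power x^(s+t-k), which leaves the
  Vandermonde convolution.\<close>

lemma binomial_pow_x_mult:
  "binomial_pow x_pow s * binomial_pow x_pow t = binomial_pow x_pow (s + t)"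
proof (rule fps_ext)
  fix k
  have "(binomial_pow x_pow s * binomial_pow x_pow t) $ k
      = (\<Sum>i=0..k. coeff_const ((s gchoose i) * (t gchoose (k - i))) * x_pow (s + t - of_nat k))"
    unfolding fps_mult_nth
  proof (rule sum.cong)
    fix i assume "i \<in> {0..k}"
    then have "(s - of_nat i) + (t - of_nat (k - i)) = s + t - of_nat k"
      by (simp add: of_nat_diff)
    then have x: "x_pow (s - of_nat i) * x_pow (t - of_nat (k - i)) = x_pow (s + t - of_nat k)"
      by (simp only: x_pow_mult)
    have "binomial_pow x_pow s $ i * binomial_pow x_pow t $ (k - i)
      = (coeff_const (s gchoose i) * coeff_const (t gchoose (k - i)))
        * (x_pow (s - of_nat i) * x_pow (t - of_nat (k - i)))"
      by (simp add: binomial_pow_def mult_ac)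
    then show "binomial_pow x_pow s $ i * binomial_pow x_pow t $ (k - i)
      = coeff_const ((s gchoose i) * (t gchoose (k - i))) * x_pow (s + t - of_nat k)"
      unfolding x coeff_const_mult .
  qed simp
  also have "\<dots> = binomial_pow x_pow (s + t) $ k"
    by (simp add: binomial_pow_def gbinomial_Vandermonde flip: sum_distrib_right coeff_const_sum)
  finally show "(binomial_pow x_pow s * binomial_pow x_pow t) $ k = binomial_pow x_pow (s + t) $ k" .
qed

lemma gbinomial_minus_one: "((- 1) gchoose k) = ((- 1) ^ k :: 'a::field_char_0)"
  using gbinomial_minus[of "1 :: 'a" k] by (simp add: binomial_gbinomial[symmetric])

text \<open>\<open>log_shift\<close> is the expansion of log(1 + y/x); its derivative in y is the
  geometric series of 1/(x + y).\<close>

lemma fps_deriv_log_shift: "fps_deriv log_shift = binomial_pow x_pow (- 1)"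
proof (rule fps_ext)
  fix k
  have "fps_deriv log_shift $ k
      = coeff_const (of_nat (Suc k) * ((- 1) ^ k / of_nat (Suc k))) * x_pow (- of_nat (Suc k))"
    by (simp add: log_shift_def coeff_const_of_nat coeff_const_mult flip: mult.assoc of_nat_Suc
        del: of_nat_Suc)
  also have "\<dots> = binomial_pow x_pow (- 1) $ k"
    by (simp add: binomial_pow_def gbinomial_minus_one del: of_nat_Suc) simp
  finally show "fps_deriv log_shift $ k = binomial_pow x_pow (- 1) $ k" .
qed

text \<open>The chain rule on the logarithmic factor produces (x + y)^(-1), which (x + y)^n absorbs.
  Hence both summands have n - 1.\<close>

lemma fps_deriv_term_add:
  "fps_deriv (term_add n m) = fps_const (coeff_const n) * term_add (n - 1) m
    + fps_const (coeff_const m) * term_add (n - 1) (m - 1)"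
proof -
  have "log_shift $ 0 = 0"
    by (simp add: log_shift_def)
  then have "fps_deriv (binomial_pow logx_pow m oo log_shift)
      = fps_const (coeff_const m) * (binomial_pow logx_pow (m - 1) oo log_shift)
        * binomial_pow x_pow (- 1)"
    by (simp add: fps_deriv_compose_comm_ring fps_deriv_binomial_pow fps_const_mult_compose
        fps_deriv_log_shift)
  then have "fps_deriv (term_add n m)
      = fps_const (coeff_const n) * binomial_pow x_pow (n - 1) * (binomial_pow logx_pow m oo log_shift)
        + fps_const (coeff_const m) * (binomial_pow x_pow n * binomial_pow x_pow (- 1))
          * (binomial_pow logx_pow (m - 1) oo log_shift)"
    by (simp add: term_add_def fps_deriv_binomial_pow mult_ac add_ac)
  then show ?thesis
    unfolding binomial_pow_x_mult by (simp add: term_add_def mult_ac)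
qed

text \<open>Here x^n is constant in y and e^(ny) reproduces itself with factor n, so the exponent of
  x does not move.\<close>

lemma fps_deriv_term_exp:
  "fps_deriv (term_exp n m) = fps_const (coeff_const n) * term_exp n m
    + fps_const (coeff_const m) * term_exp n (m - 1)"
proof -
  let ?e = "Abs_fps (\<lambda>k. coeff_const (n ^ k / fact k))"
  have e: "fps_deriv ?e = fps_const (coeff_const n) * ?e"
    by (rule fps_ext)
      (simp add: coeff_const_of_nat coeff_const_mult flip: of_nat_Suc del: of_nat_Suc)
  show ?thesis
    by (simp add: term_exp_def e fps_deriv_binomial_pow algebra_simps)
qed

lemma binomial_pow_0: "binomial_pow p s $ 0 = p s"
  by (simp add: binomial_pow_def)

lemma term_add_0: "term_add n m $ 0 = Poly_Mapping.single (n, m) 1"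
  by (simp add: term_add_def binomial_pow_0 x_pow_def logx_pow_def mult_single)

lemma term_exp_0: "term_exp n m $ 0 = Poly_Mapping.single (n, m) 1"
  by (simp add: term_exp_def binomial_pow_0 x_pow_def logx_pow_def mult_single)

section \<open>From the differential equation to the coefficients of the exponential\<close>

lemma Sum_any_scale:
  assumes "vector_space scale"
  shows "scale c (Sum_any g) = Sum_any (\<lambda>x. scale c (g x))"
proof -
  interpret vector_space scale by fact
  show ?thesis
    \<comment> \<open>A nonzero c preserves the support, so both sides vanish together if it is
      infinite; c = 0 empties the support on the right.\<close>
    by (cases "c = 0") (simp_all add: Sum_any.expand_set scale_sum_right)
qed

text \<open>The differential equation pairs shifted terms of \<open>E\<close> with unshifted
  coefficients of \<open>w\<close>. Reindexing each of its two sums moves the shift onto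
  \<open>w\<close>, where it becomes \<open>log_deriv\<close>.\<close>

lemma subst_terms_Suc:
  assumes vs: "vector_space scale"
    and keys: "\<And>n m. Poly_Mapping.keys (E n m $ k) \<subseteq> shifts n m k k"
    and deriv: "\<And>n m. fps_deriv (E n m) = fps_const (coeff_const n) * E (n - d) m
      + fps_const (coeff_const m) * E (n - d) (m - 1)"
  shows "scale (of_nat (Suc k)) ((subst_terms scale E w $ Suc k) a b)
    = (subst_terms scale E (log_deriv scale d w) $ k) a b"
proof -
  interpret vector_space scale by fact
  define c where "c j n m = Poly_Mapping.lookup (E n m $ j) (a, b)" for j n m
  have rec: "of_nat (Suc k) * c (Suc k) n m = n * c k (n - d) m + m * c k (n - d) (m - 1)" for n m
  proof -
    have "coeff_const (of_nat (Suc k)) * E n m $ Suc k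
        = coeff_const n * E (n - d) m $ k + coeff_const m * E (n - d) (m - 1) $ k"
      using arg_cong[OF deriv, of "\<lambda>F. F $ k" n m]
      by (simp add: coeff_const_of_nat flip: of_nat_Suc del: of_nat_Suc)
    from arg_cong[OF this, of "\<lambda>p. Poly_Mapping.lookup p (a, b)"] show ?thesis
      by (simp add: lookup_coeff_const_mult lookup_add c_def del: of_nat_Suc)
  qed
  define g where "g = (\<lambda>(n, m). scale (n * c k (n - d) m) (w n m))"
  define h where "h = (\<lambda>(n, m). scale (m * c k (n - d) (m - 1)) (w n m))"
  \<comment> \<open>\<open>s\<close> and \<open>t\<close> undo the shifts of the indices of
    \<open>c k\<close> in \<open>g\<close> and \<open>h\<close>.\<close>
  define s where "s = (\<lambda>(n :: complex, m :: complex). (n + d, m))"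
  define t where "t = (\<lambda>(n :: complex, m :: complex). (n + d, m + 1))"
  have bij: "bij s" "bij t"
    by (rule o_bij[of "\<lambda>(n, m). (n - d, m)"]; force simp: s_def)
      (rule o_bij[of "\<lambda>(n, m). (n - d, m - 1)"]; force simp: t_def)
  have gs: "g \<circ> s = (\<lambda>(n, m). scale (c k n m) (scale (n + d) (w (n + d) m)))"
    by (auto simp: g_def s_def fun_eq_iff mult.commute)
  have ht: "h \<circ> t = (\<lambda>(n, m). scale (c k n m) (scale (m + 1) (w (n + d) (m + 1))))"
    by (auto simp: h_def t_def fun_eq_iff mult.commute)
  \<comment> \<open>Splitting \<open>Sum_any\<close> needs finite supports. After reindexing,
    \<open>subst_terms_finite\<close> applies to each part, with the shifted and scaled coefficients
    as the series; the bijections carry finiteness back to \<open>g\<close> and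
    \<open>h\<close>.\<close>
  have fin_comp: "finite {e. (g \<circ> s) e \<noteq> 0}" "finite {e. (h \<circ> t) e \<noteq> 0}"
    using subst_terms_finite[of scale E k a b "\<lambda>n m. scale (n + d) (w (n + d) m)"]
      subst_terms_finite[of scale E k a b "\<lambda>n m. scale (m + 1) (w (n + d) (m + 1))"] vs keys
    unfolding gs ht by (simp_all add: c_def case_prod_unfold)
  have "finite (s -` {e. g e \<noteq> 0})" "finite (t -` {e. h e \<noteq> 0})"
    using fin_comp by (simp_all add: vimage_def)
  then have fin: "finite {e. g e \<noteq> 0}" "finite {e. h e \<noteq> 0}"
    by (simp_all only: finite_vimage_iff[OF bij(1)] finite_vimage_iff[OF bij(2)])
  have "scale (of_nat (Suc k)) ((subst_terms scale E w $ Suc k) a b)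
      = Sum_any (\<lambda>(n, m). scale (of_nat (Suc k) * c (Suc k) n m) (w n m))"
    by (simp add: subst_terms_def c_def Sum_any_scale[OF vs] case_prod_unfold del: of_nat_Suc)
  also have "\<dots> = Sum_any (\<lambda>e. g e + h e)"
    unfolding rec g_def h_def by (simp add: case_prod_unfold scale_left_distrib)
  also have "\<dots> = Sum_any (g \<circ> s) + Sum_any (h \<circ> t)"
    using Sum_any.reindex_cong[OF bij(1) refl, of g] Sum_any.reindex_cong[OF bij(2) refl, of h]
    by (simp add: Sum_any.distrib fin)
  also have "\<dots> = Sum_any (\<lambda>e. (g \<circ> s) e + (h \<circ> t) e)"
    using fin_comp by (rule Sum_any.distrib[symmetric])
  also have "\<dots> = (subst_terms scale E (log_deriv scale d w) $ k) a b"
    unfolding gs ht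
    by (simp add: subst_terms_def c_def log_deriv_def case_prod_unfold scale_right_distrib
        del: scale_scale)
  finally show ?thesis .
qed

lemma subst_terms_0:
  assumes "vector_space scale" and E: "\<And>n m. E n m $ 0 = Poly_Mapping.single (n, m) 1"
  shows "(subst_terms scale E w $ 0) a b = w a b"
proof -
  interpret vector_space scale by fact
  have "(subst_terms scale E w $ 0) a b = Sum_any (\<lambda>e. if e = (a, b) then w a b else 0)"
    by (simp add: subst_terms_def E lookup_single when_def case_prod_unfold prod_eq_iff
        if_distrib[of "\<lambda>c. scale c _"]) (rule Sum_any.cong, auto)
  then show ?thesis by simp
qed

lemma exp_y_log_deriv_eq_subst_terms:
  assumes vs: "vector_space scale"
    and keys: "\<And>n m k. Poly_Mapping.keys (E n m $ k) \<subseteq> shifts n m k k"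
    and E0: "\<And>n m. E n m $ 0 = Poly_Mapping.single (n, m) 1"
    and deriv: "\<And>n m. fps_deriv (E n m) = fps_const (coeff_const n) * E (n - d) m
      + fps_const (coeff_const m) * E (n - d) (m - 1)"
  shows "exp_y scale (log_deriv scale d) w = subst_terms scale E w"
proof -
  interpret vector_space scale by fact
  have "scale (1 / fact k) ((log_deriv scale d ^^ k) w a b) = (subst_terms scale E w $ k) a b"
    for k a b
  \<comment> \<open>The series must vary: the induction hypothesis is applied to
    \<open>log_deriv scale d w\<close>, with one derivation split off innermost.\<close>
  proof (induction k arbitrary: w)
    case 0
    show ?case by (simp add: subst_terms_0[OF vs E0])
  next
    case (Suc k)
    have "scale (1 / fact (Suc k)) ((log_deriv scale d ^^ Suc k) w a b)
        = scale (1 / of_nat (Suc k))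
            (scale (1 / fact k) ((log_deriv scale d ^^ k) (log_deriv scale d w) a b))"
      by (simp add: funpow_swap1)
    also have "\<dots> = scale (1 / of_nat (Suc k))
        (scale (of_nat (Suc k)) ((subst_terms scale E w $ Suc k) a b))"
      unfolding Suc.IH subst_terms_Suc[OF vs keys deriv] ..
    also have "\<dots> = (subst_terms scale E w $ Suc k) a b"
      by (simp del: of_nat_Suc)
    finally show ?case .
  qed
  then show ?thesis
    by (intro fps_ext ext) (simp add: exp_y_def)
qed

theorem theorem3p6:
  fixes scale :: "complex \<Rightarrow> 'w \<Rightarrow> 'w::ab_group_add"
    and w :: "'w log_series"
  assumes "vector_space scale"
  shows "exp_y scale (ddx scale) w = subst_add scale w \<and>
    exp_y scale (x_ddx scale) w = subst_exp scale w"
  unfolding ddx_eq_log_deriv x_ddx_eq_log_deriv subst_add_def subst_exp_def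
  \<comment> \<open>For d = 0 the required equation contains \<open>n - 0\<close>, so it is matched
    with \<open>fps_deriv_term_exp\<close> only after simplification.\<close>
  using exp_y_log_deriv_eq_subst_terms[OF assms keys_term_add term_add_0 fps_deriv_term_add]
    exp_y_log_deriv_eq_subst_terms[OF assms keys_term_exp term_exp_0, of 0] fps_deriv_term_exp
  by simp

end
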